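(* Let $\Gamma$ be an Abelian group with a generating set $\Sigma$ containing $r_1\,(\le 1)$ involutions, $r_2$ pairs of generators $(a,-a)$, and $z$ generators $b$ with $-b\notin\Sigma$. Let $k$ be the diameter of the Cayley graph $G=\mathrm{Cay}(\Gamma,\Sigma)$. Then the number of vertices of $G$ is bounded above by $$M_{AC}(r_1,r_2,z,k)=\sum_{i=0}^{r_2}\binom{r_2}{i}2^i\sum_{j=0}^{r_1}\binom{r_1}{j}\binom{k+z-j}{i+z}.$$
   Context: $\mathrm{Cay}(\Gamma,\Sigma)$, for a finite Abelian group $\Gamma$ (written additively) and a generating set $\Sigma\subseteq\Gamma\setminus\{0\}$, has vertex set $\Gamma$, with each vertex $u$ adjacent to the vertices $u+a$, $a\in\Sigma$. Here $\Sigma$ is the disjoint union of $r_1$ involutions (elements of order $2$), $r_2$ pairs $\{a,-a\}$ with $a\neq -a$, and $z$ further generators $b$ whose inverses are not in $\Sigma$. The graph is a mixed graph: involutions and pairs $\pm a$ give edges, the other generators give arcs. Distances are measured along paths in which arcs are traversed only in their direction and edges in either direction; the diameter is the maximum distance over all ordered pairs of vertices. Convention: $\binom{a}{b}=0$ whenever $a<0$ or $b>a$ (with $b\ge0$). *)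

theory Defs
  imports "HOL-Algebra.Multiplicative_Group" "HOL-Algebra.Generated_Groups"
    "Graph_Theory.Pair_Digraph" "Graph_Theory.Shortest_Path"
begin

record 'a mixed_graph =
  mverts :: "'a set"
  medges :: "'a set set"
  marcs :: "'a rel"

text \<open>
  Walks in a mixed graph are the walks of this digraph: an edge may be traversed in either
  direction, an arc only in its own.
\<close>
definition traversal :: "'a mixed_graph \<Rightarrow> ('a, 'a \<times> 'a) pre_digraph" where
  "traversal M = with_proj
     \<lparr>pverts = mverts M, parcs = marcs M \<union> {(u, v). {u, v} \<in> medges M}\<rparr>"

text \<open>
  With unit weights, \<open>\<mu>\<close> is the length of a shortest path, and \<open>\<infinity>\<close> if there is none.
\<close>
definition mdist :: "'a mixed_graph \<Rightarrow> 'a \<Rightarrow> 'a \<Rightarrow> ereal" where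
  "mdist M u v = wf_digraph.\<mu> (traversal M) (\<lambda>_. 1) u v"

definition mdiameter :: "'a mixed_graph \<Rightarrow> ereal" where
  "mdiameter M = (SUP (u, v) \<in> mverts M \<times> mverts M. mdist M u v)"

text \<open>
  The group is written multiplicatively, as in HOL-Algebra. An involution is its own inverse, so
  involutions contribute edges.
\<close>
definition Cay :: "('a, 'b) monoid_scheme \<Rightarrow> 'a set \<Rightarrow> 'a mixed_graph" where
  "Cay \<Gamma> S =
     \<lparr>mverts = carrier \<Gamma>,
      medges = {{u, u \<otimes>\<^bsub>\<Gamma>\<^esub> a} |u a. u \<in> carrier \<Gamma> \<and> a \<in> S \<and> inv\<^bsub>\<Gamma>\<^esub> a \<in> S},
      marcs = {(u, u \<otimes>\<^bsub>\<Gamma>\<^esub> a) |u a. u \<in> carrier \<Gamma> \<and> a \<in> S \<and> inv\<^bsub>\<Gamma>\<^esub> a \<notin> S}\<rparr>"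

definition involutions :: "('a, 'b) monoid_scheme \<Rightarrow> 'a set \<Rightarrow> 'a set" where
  "involutions \<Gamma> S = {a \<in> S. group.ord \<Gamma> a = 2}"

definition inverse_pairs :: "('a, 'b) monoid_scheme \<Rightarrow> 'a set \<Rightarrow> 'a set set" where
  "inverse_pairs \<Gamma> S =
     {{a, inv\<^bsub>\<Gamma>\<^esub> a} |a. a \<in> S \<and> inv\<^bsub>\<Gamma>\<^esub> a \<in> S \<and> a \<noteq> inv\<^bsub>\<Gamma>\<^esub> a}"

definition one_way_generators :: "('a, 'b) monoid_scheme \<Rightarrow> 'a set \<Rightarrow> 'a set" where
  "one_way_generators \<Gamma> S = {b \<in> S. inv\<^bsub>\<Gamma>\<^esub> b \<notin> S}"

text \<open>
  The binomial coefficient with an upper argument that may be negative, in which case it is 0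
  (unlike \<^const>\<open>gbinomial\<close>).
\<close>
definition binom :: "int \<Rightarrow> nat \<Rightarrow> nat" where
  "binom a b = (if a < 0 then 0 else nat a choose b)"

definition M_AC :: "nat \<Rightarrow> nat \<Rightarrow> nat \<Rightarrow> nat \<Rightarrow> nat" where
  "M_AC r1 r2 z k =
     (\<Sum>i = 0..r2. (r2 choose i) * 2 ^ i *
       (\<Sum>j = 0..r1. (r1 choose j) * binom (int k + int z - int j) (i + z)))"

lemma arcs_traversal_Cay:
  assumes "group \<Gamma>" and "S \<subseteq> carrier \<Gamma>"
  shows "arcs (traversal (Cay \<Gamma> S)) = {(u, u \<otimes>\<^bsub>\<Gamma>\<^esub> a) |u a. u \<in> carrier \<Gamma> \<and> a \<in> S}"
proof -
  interpret group \<Gamma> by fact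
  have rev: "\<exists>b. u = u \<otimes>\<^bsub>\<Gamma>\<^esub> a \<otimes>\<^bsub>\<Gamma>\<^esub> b \<and> b \<in> S"
    if "u \<in> carrier \<Gamma>" "a \<in> S" "inv\<^bsub>\<Gamma>\<^esub> a \<in> S" for u a
    using that assms(2) by (intro exI[of _ "inv\<^bsub>\<Gamma>\<^esub> a"]) (auto simp: m_assoc)
  show ?thesis
    using assms(2) rev by (auto simp: traversal_def Cay_def doubleton_eq_iff; blast)
qed

end

theory Submission
  imports Defs
begin

text \<open>
  Vertices at distance at most \<open>k\<close> from the identity are products of at most \<open>k\<close> generators. The
  number of such products is bounded by adjoining the generators one at a time: because the group is
  Abelian, all occurrences of a new generator can be moved to the front of a word, so that a word
  either avoids the generator or is a shorter word multiplied by it. For an involution two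
  occurrences cancel, and for a pair \<open>a\<close>, \<open>- a\<close> only one of the two signs is needed. Each of the
  resulting recursive bounds is Pascal's rule for \<open>M_AC\<close>.
\<close>

section \<open>Word balls and the splitting off of one generator\<close>

context comm_group
begin

text \<open>Inserting \<open>\<one>\<close> at every level lets a word stop early, so this is the
  ball of products of at most \<open>n\<close> letters rather than the sphere of exactly
  \<open>n\<close>. No inverses are adjoined, in keeping with arcs being one-way.\<close>

primrec word_ball :: "'a set \<Rightarrow> nat \<Rightarrow> 'a set" where
  "word_ball S 0 = {\<one>}"
| "word_ball S (Suc n) = insert \<one> (\<Union>a\<in>S. (\<otimes>) a ` word_ball S n)"

lemma word_ball_one: "\<one> \<in> word_ball S n"
  by (cases n) auto

lemma word_ball_mult: "a \<in> S \<Longrightarrow> x \<in> word_ball S n \<Longrightarrow> a \<otimes> x \<in> word_ball S (Suc n)"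
  by auto

text \<open>Lets a proof treat the trivial word under all length bounds at once, instead of
  separately at \<open>0\<close> and \<open>Suc n\<close>.\<close>

lemma word_ball_induct [consumes 1, case_names one mult]:
  assumes "x \<in> word_ball S n" "\<And>n. P n \<one>"
    "\<And>a x n. a \<in> S \<Longrightarrow> x \<in> word_ball S n \<Longrightarrow> P n x \<Longrightarrow> P (Suc n) (a \<otimes> x)"
  shows "P n x"
  using assms(1) by (induction n arbitrary: x) (auto intro: assms(2,3))

declare word_ball.simps(2) [simp del]

lemma word_ball_empty: "word_ball {} n = {\<one>}"
  by (cases n) (auto simp: word_ball.simps(2))

lemma word_ball_mono: "x \<in> word_ball S m \<Longrightarrow> S \<subseteq> T \<Longrightarrow> m \<le> n \<Longrightarrow> x \<in> word_ball T n"
proof (induction arbitrary: n rule: word_ball_induct)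
  case (mult a x m)
  then obtain n' where "n = Suc n'" "m \<le> n'"
    by (metis Suc_le_D Suc_le_mono)
  with mult show ?case
    by (auto intro: word_ball_mult)
qed (rule word_ball_one)

lemma word_ball_closed: "x \<in> word_ball S n \<Longrightarrow> S \<subseteq> carrier G \<Longrightarrow> x \<in> carrier G"
  by (induction rule: word_ball_induct) auto

lemma finite_word_ball: "finite S \<Longrightarrow> finite (word_ball S n)"
  by (induction n) (auto simp: word_ball.simps(2))

text \<open>Commutativity pulls one occurrence of \<open>a\<close> to the front. Further occurrences
  may remain, so the translated ball is still over \<open>insert a S\<close>.\<close>

lemma word_ball_insert:
  assumes "S \<subseteq> carrier G" "a \<in> carrier G"
  shows "word_ball (insert a S) (Suc n) \<subseteq>
    word_ball S (Suc n) \<union> (\<otimes>) a ` word_ball (insert a S) n"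
proof -
  \<comment> \<open>Phrased for every \<open>n\<close>, including \<open>0\<close>, so that
    induction over words applies; \<open>n = Suc m\<close> records that the letter \<open>a\<close>
    in front uses up one unit of length.\<close>
  have "x \<in> word_ball S n \<or>
      (\<exists>m y. n = Suc m \<and> y \<in> word_ball (insert a S) m \<and> x = a \<otimes> y)"
    if "x \<in> word_ball (insert a S) n" for x n
    using that
  proof (induction rule: word_ball_induct)
    case (mult s x n)
    consider "s = a" | "s \<in> S" "x \<in> word_ball S n"
      | m y where "s \<in> S" "n = Suc m" "y \<in> word_ball (insert a S) m" "x = a \<otimes> y"
      using mult by blast
    then show ?case
    proof cases
      case 3
      moreover have "y \<in> carrier G"
        using 3 assms by (intro word_ball_closed[of y "insert a S" m]) auto
      ultimately have "s \<otimes> x = a \<otimes> (s \<otimes> y)"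
        using assms by (auto intro: m_lcomm)
      with 3 show ?thesis
        by (auto intro: word_ball_mult)
    qed (use mult in \<open>auto intro: word_ball_mult\<close>)
  qed (auto intro: word_ball_one)
  then show ?thesis
    by blast
qed

text \<open>Occurrences of \<open>a\<close> cancel in twos, so at most one survives and the
  translated ball is over \<open>S\<close> alone.\<close>

lemma word_ball_insert_involution:
  assumes "S \<subseteq> carrier G" "a \<in> carrier G" "a \<otimes> a = \<one>"
  shows "word_ball (insert a S) (Suc n) \<subseteq> word_ball S (Suc n) \<union> (\<otimes>) a ` word_ball S n"
proof -
  have "x \<in> word_ball S n \<or> (\<exists>m y. n = Suc m \<and> y \<in> word_ball S m \<and> x = a \<otimes> y)"
    if "x \<in> word_ball (insert a S) n" for x n
    using that
  proof (induction rule: word_ball_induct)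
    case (mult s x n)
    consider "s = a" "x \<in> word_ball S n" | "s \<in> S" "x \<in> word_ball S n"
      | m y where "n = Suc m" "y \<in> word_ball S m" "x = a \<otimes> y"
      using mult by blast
    then show ?case
    proof cases
      case 3
      have y: "y \<in> carrier G"
        using 3 assms by (intro word_ball_closed[of y S m]) auto
      show ?thesis
      proof (cases "s = a")
        \<comment> \<open>The new \<open>a\<close> cancels the one in front; the remaining word is
          shorter than allowed.\<close>
        case True
        then have "s \<otimes> x = y"
          using 3 y assms by (simp flip: m_assoc)
        moreover have "y \<in> word_ball S (Suc n)"
          using 3 by (auto intro: word_ball_mono)
        ultimately show ?thesis
          by simp
      next
        case False
        then have "s \<in> S"
          using mult by simp
        moreover from this have "s \<otimes> x = a \<otimes> (s \<otimes> y)"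
          using 3 y assms by (auto intro: m_lcomm)
        ultimately show ?thesis
          using 3 by (auto intro: word_ball_mult)
      qed
    qed (auto intro: word_ball_mult)
  qed (auto intro: word_ball_one)
  then show ?thesis
    by blast
qed

text \<open>Occurrences of \<open>a\<close> and \<open>b\<close> cancel against each other until
  only one of the two kinds is left, possibly repeated; hence the two balls over
  \<open>insert a S\<close> and \<open>insert b S\<close>.\<close>

lemma word_ball_insert_pair:
  assumes S: "S \<subseteq> carrier G" and ab: "a \<in> carrier G" "b \<in> carrier G" "a \<otimes> b = \<one>"
  shows "word_ball (insert a (insert b S)) (Suc n) \<subseteq> word_ball S (Suc n) \<union>
    (\<otimes>) a ` word_ball (insert a S) n \<union> (\<otimes>) b ` word_ball (insert b S) n"
proof -
  \<comment> \<open>\<open>Q c n x\<close>: the element \<open>x\<close> has a word of length at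
    most \<open>n\<close> with \<open>c\<close> in front and all other letters in
    \<open>insert c S\<close>. The next three facts treat prepending \<open>c\<close>, its inverse,
    and a letter of \<open>S\<close>.\<close>
  define Q where "Q c n x \<longleftrightarrow> (\<exists>m y. n = Suc m \<and> y \<in> word_ball (insert c S) m \<and> x = c \<otimes> y)"
    for c n x
  have same: "Q c (Suc n) (c \<otimes> x)" if "Q c n x \<or> x \<in> word_ball S n" for c n x
    using that unfolding Q_def by (auto intro: word_ball_mult word_ball_mono[of _ S])
  have opposite: "c \<otimes> x \<in> word_ball S (Suc n) \<or> Q d (Suc n) (c \<otimes> x)"
    if cd: "c \<in> carrier G" "d \<in> carrier G" "c \<otimes> d = \<one>" and "Q d n x" for c d n x
  proof -
    obtain m y where y: "n = Suc m" "y \<in> word_ball (insert d S) m" "x = d \<otimes> y"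
      using \<open>Q d n x\<close> by (auto simp: Q_def)
    have "y \<in> carrier G"
      using y cd S by (intro word_ball_closed[of y "insert d S" m]) auto
    then have "c \<otimes> x = y"
      using y cd by (simp flip: m_assoc)
    \<comment> \<open>After the cancellation \<open>y\<close> may or may not contain another
      \<open>d\<close>, so it is split again. Raising its bound to \<open>Suc m = n\<close> supplies
      the successor that \<open>word_ball_insert\<close> needs and stays within the allowed
      length.\<close>
    moreover have "y \<in> word_ball (insert d S) (Suc m)"
      using y by (auto intro: word_ball_mono)
    ultimately have "c \<otimes> x \<in> word_ball S (Suc m) \<union> (\<otimes>) d ` word_ball (insert d S) m"
      using word_ball_insert[OF S cd(2)] by blast
    then show ?thesis
    proof (elim UnE imageE)
      fix y' assume "c \<otimes> x = d \<otimes> y'" "y' \<in> word_ball (insert d S) m"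
      moreover from this have "y' \<in> word_ball (insert d S) (Suc m)"
        by (auto intro: word_ball_mono)
      ultimately show ?thesis
        using y(1) by (auto simp: Q_def)
    qed (use y(1) in \<open>auto intro: word_ball_mono\<close>)
  qed
  have other: "Q c (Suc n) (s \<otimes> x)"
    if s: "s \<in> S" and c: "c \<in> carrier G" and "Q c n x" for s c n x
  proof -
    obtain m y where y: "n = Suc m" "y \<in> word_ball (insert c S) m" "x = c \<otimes> y"
      using \<open>Q c n x\<close> by (auto simp: Q_def)
    have "y \<in> carrier G"
      using y c S by (intro word_ball_closed[of y "insert c S" m]) auto
    then have "s \<otimes> x = c \<otimes> (s \<otimes> y)"
      using y s c S by (auto intro: m_lcomm)
    with y s show ?thesis
      unfolding Q_def by (auto intro: word_ball_mult)
  qed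
  have "x \<in> word_ball S n \<or> Q a n x \<or> Q b n x"
    if "x \<in> word_ball (insert a (insert b S)) n" for x n
    using that
  proof (induction rule: word_ball_induct)
    case (mult s x n)
    have "b \<otimes> a = \<one>"
      using ab m_comm by simp
    note opp = opposite[OF ab] opposite[OF ab(2,1) this]
    consider "s = a" | "s = b" | "s \<in> S"
      using mult.hyps by blast
    then show ?case
    proof cases
      case 1
      with mult.IH same[of a n x] opp(1) show ?thesis
        by blast
    next
      case 2
      with mult.IH same[of b n x] opp(2) show ?thesis
        by blast
    next
      case 3
      with mult.IH other ab show ?thesis
        by (blast intro: word_ball_mult)
    qed
  qed (auto intro: word_ball_one)
  then show ?thesis
    unfolding Q_def by blast
qed

end

section \<open>Counting a translate, and Pascal recursions for \<open>M_AC\<close>\<close>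

lemma card_le_add_translate:
  assumes "A \<subseteq> B \<union> f ` C" "finite B" "finite C"
  shows "card A \<le> card B + card C"
proof -
  have "card A \<le> card (B \<union> f ` C)"
    using assms by (intro card_mono) auto
  also have "\<dots> \<le> card B + card (f ` C)"
    by (rule card_Un_le)
  also have "\<dots> \<le> card B + card C"
    using card_image_le[OF assms(3), of f] by simp
  finally show ?thesis .
qed

text \<open>Pascal's rule summed against an arbitrary weight, so that one identity serves both the
  sum over \<open>j\<close> and the sum over \<open>i\<close>.\<close>

lemma sum_choose_Suc:
  fixes f :: "nat \<Rightarrow> nat"
  shows "(\<Sum>i=0..Suc r. (Suc r choose i) * f i) =
    (\<Sum>i=0..r. (r choose i) * f i) + (\<Sum>i=0..r. (r choose i) * f (Suc i))"
proof -
  have "(\<Sum>i=0..Suc r. (Suc r choose i) * f i) = f 0 + (\<Sum>i=0..r. (Suc r choose Suc i) * f (Suc i))"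
    by (subst sum.atLeast0_atMost_Suc_shift) simp
  also have "\<dots> = f 0 + (\<Sum>i=0..r. (r choose Suc i) * f (Suc i)) +
      (\<Sum>i=0..r. (r choose i) * f (Suc i))"
    by (simp add: sum.distrib algebra_simps)
  also have "f 0 + (\<Sum>i=0..r. (r choose Suc i) * f (Suc i)) = (\<Sum>i=0..Suc r. (r choose i) * f i)"
    by (subst sum.atLeast0_atMost_Suc_shift) simp
  finally show ?thesis
    by simp
qed

lemma M_AC_z_0: "M_AC 0 0 0 k = 1"
  by (simp add: M_AC_def binom_def)

text \<open>Here \<open>M_AC 0 0 z k\<close> is the binomial coefficient of \<open>k + z\<close>
  over \<open>z\<close>, so this is Pascal's rule itself.\<close>

lemma M_AC_z_Suc: "M_AC 0 0 (Suc z) (Suc k) = M_AC 0 0 z (Suc k) + M_AC 0 0 (Suc z) k"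
  by (simp add: M_AC_def binom_def nat_add_distrib)

text \<open>Raising \<open>j\<close> and \<open>k\<close> together leaves \<open>k + z - j\<close>
  unchanged, so the shifted sum is again an \<open>M_AC\<close>, with bound
  \<open>k\<close>.\<close>

lemma M_AC_r1_Suc: "M_AC (Suc r1) r2 z (Suc k) = M_AC r1 r2 z (Suc k) + M_AC r1 r2 z k"
  unfolding M_AC_def sum_choose_Suc[of r1]
  by (simp add: sum.distrib algebra_simps)

text \<open>Replacing \<open>i\<close> by \<open>Suc i\<close> doubles \<open>2 ^ i\<close> and
  turns the lower index into \<open>i + Suc z\<close>; the upper one agrees because
  \<open>Suc k + z = k + Suc z\<close>.\<close>

lemma M_AC_r2_Suc: "M_AC r1 (Suc r2) z (Suc k) = M_AC r1 r2 z (Suc k) + 2 * M_AC r1 r2 (Suc z) k"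
  unfolding M_AC_def mult.assoc sum_choose_Suc[of r2]
  by (simp add: sum_distrib_left algebra_simps)

text \<open>Covers radius \<open>0\<close>, where the ball is a single point and the recursions do
  not apply. The term with \<open>i = j = 0\<close> suffices.\<close>

lemma M_AC_pos: "1 \<le> M_AC r1 r2 z k"
proof -
  define t where "t i = (\<Sum>j=0..r1. (r1 choose j) * binom (int k + int z - int j) (i + z))" for i
  have "1 \<le> binom (int k + int z) z"
    by (simp add: binom_def Suc_le_eq nat_add_distrib)
  also have "\<dots> \<le> t 0"
    unfolding t_def by (subst sum.atLeast_Suc_atMost) auto
  also have "\<dots> \<le> (\<Sum>i=0..r2. (r2 choose i) * 2 ^ i * t i)"
    by (subst sum.atLeast_Suc_atMost) auto
  finally show ?thesis
    by (simp add: M_AC_def t_def)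
qed

section \<open>Cardinality of word balls\<close>

context comm_group
begin

lemma card_word_ball_one_way:
  assumes "set zs \<subseteq> carrier G"
  shows "card (word_ball (set zs) n) \<le> M_AC 0 0 (length zs) n"
  using assms
proof (induction zs arbitrary: n)
  case Nil
  show ?case
    by (simp add: word_ball_empty M_AC_z_0)
next
  case (Cons b zs)
  show ?case
  \<comment> \<open>A second induction is needed because \<open>b\<close> survives in the translated
    ball: only the radius drops there, not the list.\<close>
  proof (induction n)
    case 0
    show ?case
      using M_AC_pos by simp
  next
    case (Suc n)
    have "card (word_ball (set (b # zs)) (Suc n)) \<le>
        card (word_ball (set zs) (Suc n)) + card (word_ball (set (b # zs)) n)"
      using Cons.prems by (intro card_le_add_translate[where f = "(\<otimes>) b"])
        (auto simp: finite_word_ball dest!: word_ball_insert[THEN subsetD, rotated 2])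
    also have "\<dots> \<le> M_AC 0 0 (length zs) (Suc n) + M_AC 0 0 (length (b # zs)) n"
      using Suc Cons by (intro add_mono) auto
    finally show ?case
      by (simp add: M_AC_z_Suc)
  qed
qed

lemma card_word_ball_involutions:
  assumes "set zs \<subseteq> carrier G" "set as \<subseteq> carrier G" "\<And>a. a \<in> set as \<Longrightarrow> a \<otimes> a = \<one>"
  shows "card (word_ball (set as \<union> set zs) n) \<le> M_AC (length as) 0 (length zs) n"
  using assms(2,3)
proof (induction as arbitrary: n)
  case Nil
  show ?case
    using card_word_ball_one_way assms(1) by simp
next
  case (Cons a as)
  show ?case
  proof (cases n)
    case 0
    then show ?thesis
      using M_AC_pos by simp
  next
    case (Suc m)
    let ?S = "set as \<union> set zs"
    have "card (word_ball (insert a ?S) (Suc m)) \<le>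
        card (word_ball ?S (Suc m)) + card (word_ball ?S m)"
      using Cons.prems assms(1)
      by (intro card_le_add_translate[OF word_ball_insert_involution] finite_word_ball) auto
    also have "\<dots> \<le> M_AC (length as) 0 (length zs) (Suc m) + M_AC (length as) 0 (length zs) m"
      using Cons by (intro add_mono) auto
    finally show ?thesis
      by (simp add: M_AC_r1_Suc Suc)
  qed
qed

text \<open>Lists rather than sets, so that no disjointness has to be tracked when a generator moves from
  the pairs to \<open>zs\<close>.\<close>

lemma card_word_ball_le_M_AC:
  assumes "set zs \<subseteq> carrier G" "set as \<subseteq> carrier G" "\<And>a. a \<in> set as \<Longrightarrow> a \<otimes> a = \<one>"
    "set ps \<subseteq> carrier G"
  shows "card (word_ball (set ps \<union> m_inv G ` set ps \<union> set as \<union> set zs) n)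
    \<le> M_AC (length as) (length ps) (length zs) n"
  using assms(1,4)
proof (induction ps arbitrary: zs n)
  case Nil
  then show ?case
    using card_word_ball_involutions assms by simp
next
  case (Cons a ps)
  show ?case
  proof (cases n)
    case 0
    then show ?thesis
      using M_AC_pos by simp
  next
    case (Suc m)
    let ?S = "set ps \<union> m_inv G ` set ps \<union> set as \<union> set zs"
    let ?A = "\<lambda>a. word_ball (insert a ?S) m"
    have sub: "?S \<subseteq> carrier G" and a: "a \<in> carrier G" "inv a \<in> carrier G"
      using Cons.prems assms(2) by auto
    \<comment> \<open>The sign that is kept behaves like a one-way generator and joins
      \<open>zs\<close>, which is why the induction leaves \<open>zs\<close> arbitrary.\<close>
    have step: "card (?A b) \<le> M_AC (length as) (length ps) (Suc (length zs)) m"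
      if "b \<in> carrier G" for b
      using Cons.IH[of "b # zs" m] Cons.prems that by simp
    have "card (word_ball (insert a (insert (inv a) ?S)) (Suc m)) \<le>
        card (word_ball ?S (Suc m) \<union> (\<otimes>) a ` ?A a) + card (?A (inv a))"
      by (rule card_le_add_translate[OF word_ball_insert_pair])
        (use sub a in \<open>auto intro: finite_word_ball\<close>)
    also have "card (word_ball ?S (Suc m) \<union> (\<otimes>) a ` ?A a) \<le>
        card (word_ball ?S (Suc m)) + card (?A a)"
      by (rule card_le_add_translate[OF order_refl]) (auto intro: finite_word_ball)
    also have "card (word_ball ?S (Suc m)) \<le> M_AC (length as) (length ps) (length zs) (Suc m)"
      using Cons by simp
    also note step[OF a(1)]
    also note step[OF a(2)]
    also have "M_AC (length as) (length ps) (length zs) (Suc m) +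
        M_AC (length as) (length ps) (Suc (length zs)) m +
        M_AC (length as) (length ps) (Suc (length zs)) m =
        M_AC (length as) (length (a # ps)) (length zs) n"
      by (simp add: M_AC_r2_Suc Suc)
    finally show ?thesis
      by (simp add: Suc insert_commute)
  qed
qed

section \<open>From walks in the Cayley graph to words\<close>

lemma awalk_Cay_word_ball:
  assumes "S \<subseteq> carrier G" "pre_digraph.awalk (traversal (Cay G S)) u p v"
  shows "\<exists>x \<in> word_ball S (length p). v = u \<otimes> x"
proof -
  interpret D: pre_digraph "traversal (Cay G S)" .
  \<comment> \<open>Edges and arcs need no separate treatment: every step of a walk is right
    multiplication by some generator.\<close>
  have arcs: "arcs (traversal (Cay G S)) = {(u, u \<otimes> a) |u a. u \<in> carrier G \<and> a \<in> S}"
    using arcs_traversal_Cay[OF is_group assms(1)] .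
  have [simp]: "verts (traversal (Cay G S)) = carrier G" "tail (traversal (Cay G S)) = fst"
    "head (traversal (Cay G S)) = snd"
    by (simp_all add: traversal_def Cay_def)
  have "u \<in> carrier G" "set p \<subseteq> arcs (traversal (Cay G S))" "D.cas u p v"
    using assms(2) by (auto simp: D.awalk_def)
  then show ?thesis
  proof (induction p arbitrary: u)
    case Nil
    then show ?case
      by (auto intro!: bexI[of _ \<one>] word_ball_one)
  next
    case (Cons e p)
    obtain a where a: "a \<in> S" "e = (u, u \<otimes> a)"
      using Cons.prems by (auto simp: arcs)
    then obtain x where x: "x \<in> word_ball S (length p)" "v = u \<otimes> a \<otimes> x"
      using Cons.IH[of "u \<otimes> a"] Cons.prems assms(1) by auto
    then have "v = u \<otimes> (a \<otimes> x)"
      using word_ball_closed[OF x(1) assms(1)] a Cons.prems(1) assms(1) by (auto intro: m_assoc)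
    with x a show ?case
      by (auto intro!: bexI[of _ "a \<otimes> x"] word_ball_mult)
  qed
qed

lemma carrier_subset_word_ball:
  assumes "S \<subseteq> carrier G" "mdiameter (Cay G S) = ereal (real k)"
  shows "carrier G \<subseteq> word_ball S k"
proof
  fix v assume v: "v \<in> carrier G"
  interpret D: wf_digraph "traversal (Cay G S)"
    using arcs_traversal_Cay[OF is_group assms(1)] assms(1)
    by unfold_locales (auto simp: traversal_def Cay_def)
  have "mdist (Cay G S) \<one> v \<le> mdiameter (Cay G S)"
    unfolding mdiameter_def using v by (auto intro!: SUP_upper2[of "(\<one>, v)"] simp: Cay_def)
  \<comment> \<open>The distance is an infimum of walk costs. The strict bound \<open>k + 1\<close>
    yields an actual walk below it, and integrality of its length gives at most
    \<open>k\<close>.\<close>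
  then have "D.\<mu> (\<lambda>_. 1) \<one> v < ereal (real k + 1)"
    using assms(2) by (simp add: mdist_def order_le_less_trans)
  then obtain p where p: "D.awalk \<one> p v" "ereal (D.awalk_cost (\<lambda>_. 1) p) < ereal (real k + 1)"
    unfolding D.\<mu>_def by (auto simp: INF_less_iff)
  have "D.awalk_cost (\<lambda>_. 1) p = real (length p)"
    by (induction p) (auto simp: D.awalk_cost_def)
  with p(2) have "length p \<le> k"
    by simp
  obtain x where x: "x \<in> word_ball S (length p)" "v = \<one> \<otimes> x"
    using awalk_Cay_word_ball[OF assms(1) p(1)] by blast
  then have "v = x"
    using word_ball_closed assms(1) by simp
  with x \<open>length p \<le> k\<close> show "v \<in> word_ball S k"
    by (auto intro: word_ball_mono)
qed

section \<open>The three kinds of generators and the final count\<close>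

lemma generators_subset:
  assumes "S \<subseteq> carrier G - {\<one>}"
  shows "S \<subseteq> involutions G S \<union> \<Union>(inverse_pairs G S) \<union> one_way_generators G S"
proof
  fix a assume a: "a \<in> S"
  \<comment> \<open>Excluding \<open>\<one>\<close> from \<open>S\<close> matters here: a
    self-inverse generator has order dividing 2, and order 1 is ruled out.\<close>
  have "ord a = 2" if "inv a = a"
  proof -
    have "a [^] (2::nat) = \<one>"
      using that a assms r_inv[of a] by (auto simp: numeral_2_eq_2)
    then have "ord a dvd 2"
      using a assms by (auto simp: pow_eq_id)
    moreover have "ord a \<noteq> 1"
      using a assms ord_eq_1 by auto
    moreover from \<open>ord a dvd 2\<close> have "ord a \<le> 2" "ord a \<noteq> 0"
      by (auto dest: dvd_imp_le intro!: gr0I)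
    ultimately show ?thesis
      by linarith
  qed
  moreover have "a \<in> \<Union>(inverse_pairs G S)" if "inv a \<in> S" "inv a \<noteq> a"
  proof (rule UnionI)
    show "{a, inv a} \<in> inverse_pairs G S"
      unfolding inverse_pairs_def using that a by (intro CollectI exI[of _ a]) auto
  qed simp
  ultimately show "a \<in> involutions G S \<union> \<Union>(inverse_pairs G S) \<union> one_way_generators G S"
    using a by (cases "inv a = a"; cases "inv a \<in> S")
      (simp_all add: involutions_def one_way_generators_def)
qed

end

theorem proposition2p1:
  fixes \<Gamma> :: "('a, 'b) monoid_scheme" and S :: "'a set" and r1 r2 z k :: nat
  assumes "comm_group \<Gamma>" and "finite (carrier \<Gamma>)"
    and "S \<subseteq> carrier \<Gamma> - {\<one>\<^bsub>\<Gamma>\<^esub>}" and "generate \<Gamma> S = carrier \<Gamma>"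
    and "card (involutions \<Gamma> S) = r1" and "r1 \<le> 1"
    and "card (inverse_pairs \<Gamma> S) = r2"
    and "card (one_way_generators \<Gamma> S) = z"
    and "mdiameter (Cay \<Gamma> S) = ereal (real k)"
  shows "card (mverts (Cay \<Gamma> S)) \<le> M_AC r1 r2 z k"
proof -
  interpret comm_group \<Gamma> by fact
  have S: "S \<subseteq> carrier \<Gamma>" "finite S"
    using assms(2,3) finite_subset by auto
  have "inverse_pairs \<Gamma> S \<subseteq> Pow S"
    by (auto simp: inverse_pairs_def)
  then have fin: "finite (involutions \<Gamma> S)" "finite (inverse_pairs \<Gamma> S)"
      "finite (one_way_generators \<Gamma> S)"
    using S(2) finite_subset by (auto simp: involutions_def one_way_generators_def)
  obtain as where as: "set as = involutions \<Gamma> S" "length as = r1"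
    using fin(1) assms(5) finite_distinct_list distinct_card by metis
  obtain zs where zs: "set zs = one_way_generators \<Gamma> S" "length zs = z"
    using fin(3) assms(8) finite_distinct_list distinct_card by metis
  obtain Ps where Ps: "set Ps = inverse_pairs \<Gamma> S" "length Ps = r2"
    using fin(2) assms(7) finite_distinct_list distinct_card by metis
  have "\<forall>p \<in> inverse_pairs \<Gamma> S. \<exists>a \<in> S. p = {a, inv\<^bsub>\<Gamma>\<^esub> a}"
    by (auto simp: inverse_pairs_def)
  \<comment> \<open>\<open>f\<close> picks one sign from each pair; the other sign is recovered
    through \<open>m_inv\<close> in \<open>?T\<close>. Thus \<open>r2\<close> representatives
    account for all paired generators.\<close>
  then obtain f where f: "\<And>p. p \<in> inverse_pairs \<Gamma> S \<Longrightarrow> f p \<in> S \<and> p = {f p, inv\<^bsub>\<Gamma>\<^esub> f p}"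
    by metis
  define ps where "ps = map f Ps"
  have ps: "set ps \<subseteq> carrier \<Gamma>" "length ps = r2"
    using f S Ps by (auto simp: ps_def)
  have as_zs: "set as \<subseteq> carrier \<Gamma>" "set zs \<subseteq> carrier \<Gamma>"
    using as zs S by (auto simp: involutions_def one_way_generators_def)
  have sq: "a \<otimes>\<^bsub>\<Gamma>\<^esub> a = \<one>\<^bsub>\<Gamma>\<^esub>" if "a \<in> set as" for a
    using that as_zs as pow_ord_eq_1[of a] by (auto simp: involutions_def numeral_2_eq_2)
  let ?T = "set ps \<union> m_inv \<Gamma> ` set ps \<union> set as \<union> set zs"
  have "\<Union>(inverse_pairs \<Gamma> S) \<subseteq> set ps \<union> m_inv \<Gamma> ` set ps"
    using f Ps by (fastforce simp: ps_def)
  then have "S \<subseteq> ?T"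
    using generators_subset[OF assms(3)] as zs by blast
  then have "carrier \<Gamma> \<subseteq> word_ball ?T k"
    using carrier_subset_word_ball[OF S(1) assms(9)] word_ball_mono by blast
  then have "card (carrier \<Gamma>) \<le> card (word_ball ?T k)"
    by (intro card_mono finite_word_ball) auto
  also have "\<dots> \<le> M_AC r1 r2 z k"
    using card_word_ball_le_M_AC[OF as_zs(2,1) sq ps(1)] as zs ps by simp
  finally show ?thesis
    by (simp add: Cay_def)
qed

end
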